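(* The following properties hold: (a) Every relatively complemented lattice, and every sectionally complemented lattice, has property (C). (b) Every atomistic lattice has property (C). (c) The class of all lattices satisfying property (C) is closed under direct limits. (d) Every lattice satisfying property (C) is congruence splitting. (e) The class of all congruence splitting lattices is closed under direct limits.
   Context: For elements $a,b,c$ of a lattice $L$, write $a\lessdot_c b$ if there exists $x\in L$ such that $a\vee x=b$ and $a\wedge x\le c$. A lattice $L$ has *property (C)* if for all $a\le b$ and all $c$ in $L$, there exist a positive integer $n$ and elements $x_i$ ($0\le i\le n$) of $L$ such that $a=x_0\lessdot_c x_1\lessdot_c\cdots\lessdot_c x_n=b$. For a lattice $L$ and $u,v\in L$, $\Theta(u,v)$ is the least congruence of $L$ identifying $u$ and $v$. A lattice $L$ is *congruence splitting* if for all $a\le b$ in $L$ and all congruences $\alpha_0,\alpha_1$ of $L$ such that $\Theta(a,b)\subseteq\alpha_0\vee\alpha_1$, there are elements $x_0,x_1$ of $[a,b]$ such that $x_0\vee x_1=b$ and $\Theta(a,x_i)\subseteq\alpha_i$ for all $i<2$. A lattice with least element $0$ is *atomistic* if every element is a *finite* join of atoms (an atom is a minimal element of $L\setminus\{0\}$; $0$ is the empty join). A lattice with $0$ is sectionally complemented if every interval $[0,b]$ is complemented; a lattice is relatively complemented if every interval $[a,b]$ is complemented. Direct limits are taken over directed posets, with lattice homomorphisms as transition maps. *)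

theory Defs
  imports "HOL-Algebra.Lattice"
begin

section \<open>Property (C)\<close>

text \<open>\<open>lessdot L c a b\<close> stands for \<open>a \<lessdot>\<^sub>c b\<close>.\<close>

definition lessdot :: "'a gorder \<Rightarrow> 'a \<Rightarrow> 'a \<Rightarrow> 'a \<Rightarrow> bool"
  where "lessdot L c a b \<longleftrightarrow> (\<exists>x\<in>carrier L. a \<squnion>\<^bsub>L\<^esub> x = b \<and> a \<sqinter>\<^bsub>L\<^esub> x \<sqsubseteq>\<^bsub>L\<^esub> c)"

definition property_C :: "'a gorder \<Rightarrow> bool"
  where "property_C L \<longleftrightarrow>
    (\<forall>a\<in>carrier L. \<forall>b\<in>carrier L. \<forall>c\<in>carrier L. a \<sqsubseteq>\<^bsub>L\<^esub> b \<longrightarrow>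
      (\<exists>n::nat. \<exists>x::nat \<Rightarrow> 'a. 0 < n \<and> (\<forall>i\<le>n. x i \<in> carrier L) \<and>
        x 0 = a \<and> x n = b \<and> (\<forall>i<n. lessdot L c (x i) (x (Suc i)))))"


section \<open>Congruences\<close>

definition lattice_congruence :: "'a gorder \<Rightarrow> 'a rel \<Rightarrow> bool"
  where "lattice_congruence L \<theta> \<longleftrightarrow> equiv (carrier L) \<theta> \<and>
    (\<forall>x x' y y'. (x, x') \<in> \<theta> \<longrightarrow> (y, y') \<in> \<theta> \<longrightarrow>
      (x \<squnion>\<^bsub>L\<^esub> y, x' \<squnion>\<^bsub>L\<^esub> y') \<in> \<theta> \<and> (x \<sqinter>\<^bsub>L\<^esub> y, x' \<sqinter>\<^bsub>L\<^esub> y') \<in> \<theta>)"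

definition cong_generated :: "'a gorder \<Rightarrow> 'a rel \<Rightarrow> 'a rel"
  where "cong_generated L R = \<Inter>{\<theta>. lattice_congruence L \<theta> \<and> R \<subseteq> \<theta>}"

definition principal_cong :: "'a gorder \<Rightarrow> 'a \<Rightarrow> 'a \<Rightarrow> 'a rel"
  where "principal_cong L u v = cong_generated L {(u, v)}"

text \<open>The join in the lattice of congruences of \<open>L\<close> ordered by inclusion.\<close>

definition cong_join :: "'a gorder \<Rightarrow> 'a rel \<Rightarrow> 'a rel \<Rightarrow> 'a rel"
  where "cong_join L \<alpha> \<beta> = cong_generated L (\<alpha> \<union> \<beta>)"

definition congruence_splitting :: "'a gorder \<Rightarrow> bool"
  where "congruence_splitting L \<longleftrightarrow>
    (\<forall>a\<in>carrier L. \<forall>b\<in>carrier L. a \<sqsubseteq>\<^bsub>L\<^esub> b \<longrightarrow>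
      (\<forall>\<alpha>\<^sub>0 \<alpha>\<^sub>1. lattice_congruence L \<alpha>\<^sub>0 \<longrightarrow> lattice_congruence L \<alpha>\<^sub>1 \<longrightarrow>
        principal_cong L a b \<subseteq> cong_join L \<alpha>\<^sub>0 \<alpha>\<^sub>1 \<longrightarrow>
        (\<exists>x\<^sub>0\<in>\<lbrace>a..b\<rbrace>\<^bsub>L\<^esub>. \<exists>x\<^sub>1\<in>\<lbrace>a..b\<rbrace>\<^bsub>L\<^esub>. x\<^sub>0 \<squnion>\<^bsub>L\<^esub> x\<^sub>1 = b \<and>
          principal_cong L a x\<^sub>0 \<subseteq> \<alpha>\<^sub>0 \<and> principal_cong L a x\<^sub>1 \<subseteq> \<alpha>\<^sub>1)))"


section \<open>Complemented and atomistic lattices\<close>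

definition complemented_interval :: "'a gorder \<Rightarrow> 'a \<Rightarrow> 'a \<Rightarrow> bool"
  where "complemented_interval L a b \<longleftrightarrow>
    (\<forall>x\<in>\<lbrace>a..b\<rbrace>\<^bsub>L\<^esub>. \<exists>y\<in>\<lbrace>a..b\<rbrace>\<^bsub>L\<^esub>. x \<sqinter>\<^bsub>L\<^esub> y = a \<and> x \<squnion>\<^bsub>L\<^esub> y = b)"

definition relatively_complemented :: "'a gorder \<Rightarrow> bool"
  where "relatively_complemented L \<longleftrightarrow>
    (\<forall>a\<in>carrier L. \<forall>b\<in>carrier L. a \<sqsubseteq>\<^bsub>L\<^esub> b \<longrightarrow> complemented_interval L a b)"

definition sectionally_complemented :: "'a gorder \<Rightarrow> bool"
  where "sectionally_complemented L \<longleftrightarrow> weak_partial_order_bottom L \<and>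
    (\<forall>b\<in>carrier L. complemented_interval L \<bottom>\<^bsub>L\<^esub> b)"

definition lattice_atom :: "'a gorder \<Rightarrow> 'a \<Rightarrow> bool"
  where "lattice_atom L p \<longleftrightarrow> p \<in> carrier L - {\<bottom>\<^bsub>L\<^esub>} \<and>
    (\<forall>x\<in>carrier L - {\<bottom>\<^bsub>L\<^esub>}. x \<sqsubseteq>\<^bsub>L\<^esub> p \<longrightarrow> x = p)"

definition atomistic :: "'a gorder \<Rightarrow> bool"
  where "atomistic L \<longleftrightarrow> weak_partial_order_bottom L \<and>
    (\<forall>x\<in>carrier L. \<exists>A. finite A \<and> A \<subseteq> {p. lattice_atom L p} \<and> x = \<Squnion>\<^bsub>L\<^esub>A)"

lemma Sup_empty_eq_bottom: "\<Squnion>\<^bsub>L\<^esub>{} = \<bottom>\<^bsub>L\<^esub>"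
  by (simp add: Lattice.sup_def bottom_def)


section \<open>Direct limits\<close>

definition lattice_hom :: "'a gorder \<Rightarrow> 'b gorder \<Rightarrow> ('a \<Rightarrow> 'b) set"
  where "lattice_hom L M = {h \<in> carrier L \<rightarrow> carrier M. join_pres L M h \<and> meet_pres L M h}"

definition lattice_iso :: "'a gorder \<Rightarrow> 'b gorder \<Rightarrow> ('a \<Rightarrow> 'b) set"
  where "lattice_iso L M = {h \<in> lattice_hom L M. bij_betw h (carrier L) (carrier M)}"

text \<open>
  Taking all carriers in one type \<open>'a\<close> loses nothing up to isomorphism, since any family of lattices
  indexed by a set can be embedded into a common type.
\<close>

locale lattice_direct_system =
  fixes I :: "'i gorder" and D :: "'i \<Rightarrow> 'a gorder" and \<phi> :: "'i \<Rightarrow> 'i \<Rightarrow> 'a \<Rightarrow> 'a"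
  assumes index_order: "partial_order I"
    and index_nonempty: "carrier I \<noteq> {}"
    and index_directed: "\<lbrakk>i \<in> carrier I; j \<in> carrier I\<rbrakk> \<Longrightarrow>
      \<exists>k\<in>carrier I. i \<sqsubseteq>\<^bsub>I\<^esub> k \<and> j \<sqsubseteq>\<^bsub>I\<^esub> k"
    and lattice: "i \<in> carrier I \<Longrightarrow> lattice (D i)"
    and hom: "\<lbrakk>i \<in> carrier I; j \<in> carrier I; i \<sqsubseteq>\<^bsub>I\<^esub> j\<rbrakk> \<Longrightarrow> \<phi> i j \<in> lattice_hom (D i) (D j)"
    and map_id: "\<lbrakk>i \<in> carrier I; x \<in> carrier (D i)\<rbrakk> \<Longrightarrow> \<phi> i i x = x"
    and map_comp: "\<lbrakk>i \<in> carrier I; j \<in> carrier I; k \<in> carrier I; i \<sqsubseteq>\<^bsub>I\<^esub> j; j \<sqsubseteq>\<^bsub>I\<^esub> k; x \<in> carrier (D i)\<rbrakk>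
      \<Longrightarrow> \<phi> j k (\<phi> i j x) = \<phi> i k x"

text \<open>
  The direct limit is the disjoint union of the \<open>D i\<close>, with two elements identified when they
  have the same image in some \<open>D k\<close>.
\<close>

definition limit_rel ::
    "'i gorder \<Rightarrow> ('i \<Rightarrow> 'a gorder) \<Rightarrow> ('i \<Rightarrow> 'i \<Rightarrow> 'a \<Rightarrow> 'a) \<Rightarrow> ('i \<times> 'a) rel"
  where "limit_rel I D \<phi> =
    {((i, x), (j, y)). i \<in> carrier I \<and> x \<in> carrier (D i) \<and> j \<in> carrier I \<and> y \<in> carrier (D j) \<and>
      (\<exists>k\<in>carrier I. i \<sqsubseteq>\<^bsub>I\<^esub> k \<and> j \<sqsubseteq>\<^bsub>I\<^esub> k \<and> \<phi> i k x = \<phi> j k y)}"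

definition direct_limit ::
    "'i gorder \<Rightarrow> ('i \<Rightarrow> 'a gorder) \<Rightarrow> ('i \<Rightarrow> 'i \<Rightarrow> 'a \<Rightarrow> 'a) \<Rightarrow> ('i \<times> 'a) set gorder"
  where "direct_limit I D \<phi> =
    \<lparr> carrier = (SIGMA i:carrier I. carrier (D i)) // limit_rel I D \<phi>,
      eq = (=),
      le = (\<lambda>X Y. \<exists>(i, x)\<in>X. \<exists>(j, y)\<in>Y. \<exists>k\<in>carrier I.
              i \<sqsubseteq>\<^bsub>I\<^esub> k \<and> j \<sqsubseteq>\<^bsub>I\<^esub> k \<and> \<phi> i k x \<sqsubseteq>\<^bsub>D k\<^esub> \<phi> j k y) \<rparr>"

definition limit_map ::
    "'i gorder \<Rightarrow> ('i \<Rightarrow> 'a gorder) \<Rightarrow> ('i \<Rightarrow> 'i \<Rightarrow> 'a \<Rightarrow> 'a) \<Rightarrow> 'i \<Rightarrow> 'a \<Rightarrow> ('i \<times> 'a) set"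
  where "limit_map I D \<phi> i x = limit_rel I D \<phi> `` {(i, x)}"

text \<open>Direct limits are only determined up to isomorphism.\<close>

definition is_direct_limit ::
    "'i gorder \<Rightarrow> ('i \<Rightarrow> 'a gorder) \<Rightarrow> ('i \<Rightarrow> 'i \<Rightarrow> 'a \<Rightarrow> 'a) \<Rightarrow> 'b gorder \<Rightarrow> bool"
  where "is_direct_limit I D \<phi> M \<longleftrightarrow> lattice_direct_system I D \<phi> \<and>
    (\<exists>h. h \<in> lattice_iso (direct_limit I D \<phi>) M)"

lemma lattice_hom_mono:
  assumes "h \<in> lattice_hom L M" "x \<in> carrier L" "y \<in> carrier L" "x \<sqsubseteq>\<^bsub>L\<^esub> y"
  shows "h x \<sqsubseteq>\<^bsub>M\<^esub> h y"
  using join_pres_isotone[of h L M] use_iso2[of L M h x y] assms by (auto simp: lattice_hom_def)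

lemma joinI_lub:
  assumes "lattice L" "x \<in> carrier L" "y \<in> carrier L" "z \<in> carrier L"
    "x \<sqsubseteq>\<^bsub>L\<^esub> z" "y \<sqsubseteq>\<^bsub>L\<^esub> z"
    "\<And>w. \<lbrakk>w \<in> carrier L; x \<sqsubseteq>\<^bsub>L\<^esub> w; y \<sqsubseteq>\<^bsub>L\<^esub> w\<rbrakk> \<Longrightarrow> z \<sqsubseteq>\<^bsub>L\<^esub> w"
  shows "x \<squnion>\<^bsub>L\<^esub> y = z"
proof -
  interpret lattice L by fact
  show ?thesis
    using assms(2-6) by (intro le_antisym join_le join_closed assms(7) join_left join_right)
qed

lemma meetI_glb:
  assumes "lattice L" "x \<in> carrier L" "y \<in> carrier L" "z \<in> carrier L"
    "z \<sqsubseteq>\<^bsub>L\<^esub> x" "z \<sqsubseteq>\<^bsub>L\<^esub> y"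
    "\<And>w. \<lbrakk>w \<in> carrier L; w \<sqsubseteq>\<^bsub>L\<^esub> x; w \<sqsubseteq>\<^bsub>L\<^esub> y\<rbrakk> \<Longrightarrow> w \<sqsubseteq>\<^bsub>L\<^esub> z"
  shows "x \<sqinter>\<^bsub>L\<^esub> y = z"
proof -
  interpret lattice L by fact
  show ?thesis
    using assms(2-6) by (intro le_antisym meet_le meet_closed assms(7) meet_left meet_right)
qed

context lattice_direct_system
begin

abbreviation "Lim \<equiv> direct_limit I D \<phi>"
abbreviation "\<iota> \<equiv> limit_map I D \<phi>"

lemma index_trans:
  "\<lbrakk>i \<sqsubseteq>\<^bsub>I\<^esub> j; j \<sqsubseteq>\<^bsub>I\<^esub> k; i \<in> carrier I; j \<in> carrier I; k \<in> carrier I\<rbrakk> \<Longrightarrow> i \<sqsubseteq>\<^bsub>I\<^esub> k"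
  using index_order partial_order.axioms(1) weak_partial_order.le_trans by metis

lemma index_refl: "i \<in> carrier I \<Longrightarrow> i \<sqsubseteq>\<^bsub>I\<^esub> i"
  using index_order partial_order.axioms(1) weak_partial_order.le_refl by metis

lemma map_closed:
  "\<lbrakk>i \<in> carrier I; j \<in> carrier I; i \<sqsubseteq>\<^bsub>I\<^esub> j; x \<in> carrier (D i)\<rbrakk> \<Longrightarrow> \<phi> i j x \<in> carrier (D j)"
  using hom by (auto simp: lattice_hom_def)

lemma map_mono:
  "\<lbrakk>i \<in> carrier I; j \<in> carrier I; i \<sqsubseteq>\<^bsub>I\<^esub> j; x \<in> carrier (D i); y \<in> carrier (D i); x \<sqsubseteq>\<^bsub>D i\<^esub> y\<rbrakk>
    \<Longrightarrow> \<phi> i j x \<sqsubseteq>\<^bsub>D j\<^esub> \<phi> i j y"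
  using hom lattice_hom_mono by metis

lemma map_join:
  "\<lbrakk>i \<in> carrier I; j \<in> carrier I; i \<sqsubseteq>\<^bsub>I\<^esub> j; x \<in> carrier (D i); y \<in> carrier (D i)\<rbrakk>
    \<Longrightarrow> \<phi> i j (x \<squnion>\<^bsub>D i\<^esub> y) = \<phi> i j x \<squnion>\<^bsub>D j\<^esub> \<phi> i j y"
  using hom[of i j] by (auto simp: lattice_hom_def join_pres_def)

lemma map_meet:
  "\<lbrakk>i \<in> carrier I; j \<in> carrier I; i \<sqsubseteq>\<^bsub>I\<^esub> j; x \<in> carrier (D i); y \<in> carrier (D i)\<rbrakk>
    \<Longrightarrow> \<phi> i j (x \<sqinter>\<^bsub>D i\<^esub> y) = \<phi> i j x \<sqinter>\<^bsub>D j\<^esub> \<phi> i j y"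
  using hom[of i j] by (auto simp: lattice_hom_def meet_pres_def)

lemma equiv_limit_rel: "equiv (SIGMA i:carrier I. carrier (D i)) (limit_rel I D \<phi>)"
proof (rule equivI)
  show "limit_rel I D \<phi> \<subseteq> (SIGMA i:carrier I. carrier (D i)) \<times> (SIGMA i:carrier I. carrier (D i))"
    by (auto simp: limit_rel_def)
  show "refl_on (SIGMA i:carrier I. carrier (D i)) (limit_rel I D \<phi>)"
    by (auto simp: limit_rel_def refl_on_def intro: index_refl)
  show "sym (limit_rel I D \<phi>)"
    unfolding sym_def limit_rel_def by fastforce
  show "trans (limit_rel I D \<phi>)"
  proof (rule transI, clarsimp simp: limit_rel_def)
    fix i x j y k z l m
    assume *: "i \<in> carrier I" "x \<in> carrier (D i)" "j \<in> carrier I" "y \<in> carrier (D j)"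
      "k \<in> carrier I" "z \<in> carrier (D k)" "l \<in> carrier I" "m \<in> carrier I"
      "i \<sqsubseteq>\<^bsub>I\<^esub> l" "j \<sqsubseteq>\<^bsub>I\<^esub> l" "\<phi> i l x = \<phi> j l y" "j \<sqsubseteq>\<^bsub>I\<^esub> m" "k \<sqsubseteq>\<^bsub>I\<^esub> m" "\<phi> j m y = \<phi> k m z"
    obtain n where n: "n \<in> carrier I" "l \<sqsubseteq>\<^bsub>I\<^esub> n" "m \<sqsubseteq>\<^bsub>I\<^esub> n"
      using index_directed * by blast
    have "\<phi> i n x = \<phi> k n z"
      using map_comp[of i l n x] map_comp[of j l n y] map_comp[of j m n y] map_comp[of k m n z] * n
      by simp
    then show "\<exists>n\<in>carrier I. i \<sqsubseteq>\<^bsub>I\<^esub> n \<and> k \<sqsubseteq>\<^bsub>I\<^esub> n \<and> \<phi> i n x = \<phi> k n z"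
      using * n index_trans by blast
  qed
qed

lemma limit_map_closed: "\<lbrakk>i \<in> carrier I; x \<in> carrier (D i)\<rbrakk> \<Longrightarrow> \<iota> i x \<in> carrier Lim"
  by (auto simp: direct_limit_def limit_map_def intro!: quotientI)

lemma limit_map_eq_iff:
  assumes "i \<in> carrier I" "x \<in> carrier (D i)" "j \<in> carrier I" "y \<in> carrier (D j)"
  shows "\<iota> i x = \<iota> j y \<longleftrightarrow> (\<exists>k\<in>carrier I. i \<sqsubseteq>\<^bsub>I\<^esub> k \<and> j \<sqsubseteq>\<^bsub>I\<^esub> k \<and> \<phi> i k x = \<phi> j k y)"
  using eq_equiv_class_iff[OF equiv_limit_rel, of "(i, x)" "(j, y)"] assms
  by (auto simp: limit_map_def limit_rel_def)

lemma limit_map_compat: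
  assumes "i \<in> carrier I" "j \<in> carrier I" "i \<sqsubseteq>\<^bsub>I\<^esub> j" "x \<in> carrier (D i)"
  shows "\<iota> j (\<phi> i j x) = \<iota> i x"
  using assms map_closed index_refl map_comp
  by (subst limit_map_eq_iff) (auto intro!: bexI[of _ j])

lemma limit_le_iff:
  assumes "i \<in> carrier I" "x \<in> carrier (D i)" "j \<in> carrier I" "y \<in> carrier (D j)"
  shows "\<iota> i x \<sqsubseteq>\<^bsub>Lim\<^esub> \<iota> j y \<longleftrightarrow>
    (\<exists>k\<in>carrier I. i \<sqsubseteq>\<^bsub>I\<^esub> k \<and> j \<sqsubseteq>\<^bsub>I\<^esub> k \<and> \<phi> i k x \<sqsubseteq>\<^bsub>D k\<^esub> \<phi> j k y)" (is "?l \<longleftrightarrow> ?r")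
proof
  assume ?r
  moreover have "(i, x) \<in> \<iota> i x" "(j, y) \<in> \<iota> j y"
    using assms index_refl by (auto simp: limit_map_def limit_rel_def)
  ultimately show ?l by (fastforce simp: direct_limit_def)
next
  assume ?l
  then obtain i' x' j' y' k where 1: "(i', x') \<in> \<iota> i x" "(j', y') \<in> \<iota> j y"
    "k \<in> carrier I" "i' \<sqsubseteq>\<^bsub>I\<^esub> k" "j' \<sqsubseteq>\<^bsub>I\<^esub> k" "\<phi> i' k x' \<sqsubseteq>\<^bsub>D k\<^esub> \<phi> j' k y'"
    by (auto simp: direct_limit_def)
  then obtain l m where 2: "i' \<in> carrier I" "x' \<in> carrier (D i')" "j' \<in> carrier I" "y' \<in> carrier (D j')"
    "l \<in> carrier I" "i \<sqsubseteq>\<^bsub>I\<^esub> l" "i' \<sqsubseteq>\<^bsub>I\<^esub> l" "\<phi> i l x = \<phi> i' l x'"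
    "m \<in> carrier I" "j \<sqsubseteq>\<^bsub>I\<^esub> m" "j' \<sqsubseteq>\<^bsub>I\<^esub> m" "\<phi> j m y = \<phi> j' m y'"
    by (auto simp: limit_map_def limit_rel_def)
  obtain n where n: "n \<in> carrier I" "l \<sqsubseteq>\<^bsub>I\<^esub> n" "m \<sqsubseteq>\<^bsub>I\<^esub> n" "k \<sqsubseteq>\<^bsub>I\<^esub> n"
  proof -
    obtain n' where n': "n' \<in> carrier I" "l \<sqsubseteq>\<^bsub>I\<^esub> n'" "m \<sqsubseteq>\<^bsub>I\<^esub> n'" using index_directed 2 by blast
    obtain n where n: "n \<in> carrier I" "n' \<sqsubseteq>\<^bsub>I\<^esub> n" "k \<sqsubseteq>\<^bsub>I\<^esub> n" using index_directed n' 1 by blast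
    show ?thesis using n n' 2 index_trans by (intro that[of n]) blast+
  qed
  have "\<phi> k n (\<phi> i' k x') \<sqsubseteq>\<^bsub>D n\<^esub> \<phi> k n (\<phi> j' k y')"
    using 1 2 n by (intro map_mono map_closed) auto
  moreover have "\<phi> k n (\<phi> i' k x') = \<phi> i n x"
    using map_comp[of i' k n x'] map_comp[of i' l n x'] map_comp[of i l n x] 1 2 n assms by simp
  moreover have "\<phi> k n (\<phi> j' k y') = \<phi> j n y"
    using map_comp[of j' k n y'] map_comp[of j' m n y'] map_comp[of j m n y] 1 2 n assms by simp
  moreover have "i \<sqsubseteq>\<^bsub>I\<^esub> n" "j \<sqsubseteq>\<^bsub>I\<^esub> n" using n 2 assms index_trans by blast+
  ultimately show ?r using n by auto
qed

lemma limit_carrierE: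
  assumes "X \<in> carrier Lim"
  obtains i x where "i \<in> carrier I" "x \<in> carrier (D i)" "X = \<iota> i x"
  using assms by (auto simp: direct_limit_def limit_map_def elim!: quotientE)

lemma limit_carrier2E:
  assumes "X \<in> carrier Lim" "Y \<in> carrier Lim"
  obtains k x y where "k \<in> carrier I" "x \<in> carrier (D k)" "y \<in> carrier (D k)" "X = \<iota> k x" "Y = \<iota> k y"
proof -
  obtain i x j y where *: "i \<in> carrier I" "x \<in> carrier (D i)" "X = \<iota> i x"
    "j \<in> carrier I" "y \<in> carrier (D j)" "Y = \<iota> j y"
    using limit_carrierE assms by metis
  obtain k where "k \<in> carrier I" "i \<sqsubseteq>\<^bsub>I\<^esub> k" "j \<sqsubseteq>\<^bsub>I\<^esub> k"
    using index_directed * by blast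
  then show ?thesis using * limit_map_compat map_closed by (intro that[of k "\<phi> i k x" "\<phi> j k y"]) auto
qed

lemma limit_map_mono:
  assumes "i \<in> carrier I" "x \<in> carrier (D i)" "y \<in> carrier (D i)" "x \<sqsubseteq>\<^bsub>D i\<^esub> y"
  shows "\<iota> i x \<sqsubseteq>\<^bsub>Lim\<^esub> \<iota> i y"
  using assms index_refl map_id by (subst limit_le_iff) (auto intro!: bexI[of _ i])

lemma limit_join_le:
  assumes "i \<in> carrier I" "x \<in> carrier (D i)" "y \<in> carrier (D i)"
    and "W \<in> carrier Lim" "\<iota> i x \<sqsubseteq>\<^bsub>Lim\<^esub> W" "\<iota> i y \<sqsubseteq>\<^bsub>Lim\<^esub> W"
  shows "\<iota> i (x \<squnion>\<^bsub>D i\<^esub> y) \<sqsubseteq>\<^bsub>Lim\<^esub> W"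
proof -
  obtain j w where w: "j \<in> carrier I" "w \<in> carrier (D j)" "W = \<iota> j w"
    using assms limit_carrierE by metis
  obtain k l where kl: "k \<in> carrier I" "i \<sqsubseteq>\<^bsub>I\<^esub> k" "j \<sqsubseteq>\<^bsub>I\<^esub> k" "\<phi> i k x \<sqsubseteq>\<^bsub>D k\<^esub> \<phi> j k w"
    "l \<in> carrier I" "i \<sqsubseteq>\<^bsub>I\<^esub> l" "j \<sqsubseteq>\<^bsub>I\<^esub> l" "\<phi> i l y \<sqsubseteq>\<^bsub>D l\<^esub> \<phi> j l w"
    using assms w limit_le_iff by auto
  obtain n where n: "n \<in> carrier I" "k \<sqsubseteq>\<^bsub>I\<^esub> n" "l \<sqsubseteq>\<^bsub>I\<^esub> n" using index_directed kl by blast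
  have le: "i \<sqsubseteq>\<^bsub>I\<^esub> n" "j \<sqsubseteq>\<^bsub>I\<^esub> n" using index_trans kl n assms w by blast+
  interpret n: lattice "D n" using lattice n by blast
  interpret i: lattice "D i" using lattice assms by blast
  have "\<phi> k n (\<phi> i k x) \<sqsubseteq>\<^bsub>D n\<^esub> \<phi> k n (\<phi> j k w)" "\<phi> l n (\<phi> i l y) \<sqsubseteq>\<^bsub>D n\<^esub> \<phi> l n (\<phi> j l w)"
    using kl n assms w by (intro map_mono map_closed; simp)+
  then have "\<phi> i n x \<sqsubseteq>\<^bsub>D n\<^esub> \<phi> j n w" "\<phi> i n y \<sqsubseteq>\<^bsub>D n\<^esub> \<phi> j n w"
    using kl n assms w by (simp_all add: map_comp)
  then have "\<phi> i n (x \<squnion>\<^bsub>D i\<^esub> y) \<sqsubseteq>\<^bsub>D n\<^esub> \<phi> j n w"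
    using n assms w le map_closed by (simp add: map_join n.join_le)
  then show ?thesis using n assms w le by (simp add: limit_le_iff) blast
qed

lemma limit_le_meet:
  assumes "i \<in> carrier I" "x \<in> carrier (D i)" "y \<in> carrier (D i)"
    and "W \<in> carrier Lim" "W \<sqsubseteq>\<^bsub>Lim\<^esub> \<iota> i x" "W \<sqsubseteq>\<^bsub>Lim\<^esub> \<iota> i y"
  shows "W \<sqsubseteq>\<^bsub>Lim\<^esub> \<iota> i (x \<sqinter>\<^bsub>D i\<^esub> y)"
proof -
  obtain j w where w: "j \<in> carrier I" "w \<in> carrier (D j)" "W = \<iota> j w"
    using assms limit_carrierE by metis
  obtain k l where kl: "k \<in> carrier I" "i \<sqsubseteq>\<^bsub>I\<^esub> k" "j \<sqsubseteq>\<^bsub>I\<^esub> k" "\<phi> j k w \<sqsubseteq>\<^bsub>D k\<^esub> \<phi> i k x"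
    "l \<in> carrier I" "i \<sqsubseteq>\<^bsub>I\<^esub> l" "j \<sqsubseteq>\<^bsub>I\<^esub> l" "\<phi> j l w \<sqsubseteq>\<^bsub>D l\<^esub> \<phi> i l y"
    using assms w limit_le_iff by auto
  obtain n where n: "n \<in> carrier I" "k \<sqsubseteq>\<^bsub>I\<^esub> n" "l \<sqsubseteq>\<^bsub>I\<^esub> n" using index_directed kl by blast
  have le: "i \<sqsubseteq>\<^bsub>I\<^esub> n" "j \<sqsubseteq>\<^bsub>I\<^esub> n" using index_trans kl n assms w by blast+
  interpret n: lattice "D n" using lattice n by blast
  interpret i: lattice "D i" using lattice assms by blast
  have "\<phi> k n (\<phi> j k w) \<sqsubseteq>\<^bsub>D n\<^esub> \<phi> k n (\<phi> i k x)" "\<phi> l n (\<phi> j l w) \<sqsubseteq>\<^bsub>D n\<^esub> \<phi> l n (\<phi> i l y)"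
    using kl n assms w by (intro map_mono map_closed; simp)+
  then have "\<phi> j n w \<sqsubseteq>\<^bsub>D n\<^esub> \<phi> i n x" "\<phi> j n w \<sqsubseteq>\<^bsub>D n\<^esub> \<phi> i n y"
    using kl n assms w by (simp_all add: map_comp)
  then have "\<phi> j n w \<sqsubseteq>\<^bsub>D n\<^esub> \<phi> i n (x \<sqinter>\<^bsub>D i\<^esub> y)"
    using n assms w le map_closed by (simp add: map_meet n.meet_le)
  then show ?thesis using n assms w le by (simp add: limit_le_iff) blast
qed

lemma partial_order_limit: "partial_order Lim"
proof -
  have eq: "eq Lim = (=)" by (simp add: direct_limit_def)
  show ?thesis
  proof (unfold_locales, simp_all add: eq)
    fix X assume "X \<in> carrier Lim"
    then obtain i x where "i \<in> carrier I" "x \<in> carrier (D i)" "X = \<iota> i x" by (rule limit_carrierE)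
    note i = this
    interpret i: lattice "D i" using lattice i by blast
    show "X \<sqsubseteq>\<^bsub>Lim\<^esub> X" using limit_map_mono i by simp
  next
    fix X Y assume *: "X \<sqsubseteq>\<^bsub>Lim\<^esub> Y" "Y \<sqsubseteq>\<^bsub>Lim\<^esub> X" "X \<in> carrier Lim" "Y \<in> carrier Lim"
    obtain i x y where i: "i \<in> carrier I" "x \<in> carrier (D i)" "y \<in> carrier (D i)" "X = \<iota> i x" "Y = \<iota> i y"
      using * limit_carrier2E by metis
    interpret i: lattice "D i" using lattice i by blast
    have "\<iota> i (x \<squnion>\<^bsub>D i\<^esub> y) \<sqsubseteq>\<^bsub>Lim\<^esub> \<iota> i (x \<sqinter>\<^bsub>D i\<^esub> y)"
    proof (rule limit_join_le)
      have "\<iota> i z \<sqsubseteq>\<^bsub>Lim\<^esub> \<iota> i z" if "z \<in> carrier (D i)" for z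
        using limit_map_mono i that by simp
      then show "\<iota> i x \<sqsubseteq>\<^bsub>Lim\<^esub> \<iota> i (x \<sqinter>\<^bsub>D i\<^esub> y)" "\<iota> i y \<sqsubseteq>\<^bsub>Lim\<^esub> \<iota> i (x \<sqinter>\<^bsub>D i\<^esub> y)"
        using * i limit_map_closed limit_le_meet by metis+
    qed (use i limit_map_closed in auto)
    then obtain k where k: "k \<in> carrier I" "i \<sqsubseteq>\<^bsub>I\<^esub> k"
      "\<phi> i k (x \<squnion>\<^bsub>D i\<^esub> y) \<sqsubseteq>\<^bsub>D k\<^esub> \<phi> i k (x \<sqinter>\<^bsub>D i\<^esub> y)"
      using i by (auto simp: limit_le_iff)
    interpret k: lattice "D k" using lattice k by blast
    have c: "\<phi> i k x \<in> carrier (D k)" "\<phi> i k y \<in> carrier (D k)" using i k map_closed by auto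
    have le: "\<phi> i k x \<squnion>\<^bsub>D k\<^esub> \<phi> i k y \<sqsubseteq>\<^bsub>D k\<^esub> \<phi> i k x \<sqinter>\<^bsub>D k\<^esub> \<phi> i k y"
      using i k by (simp add: map_join map_meet)
    have "\<phi> i k x = \<phi> i k y"
    proof (intro k.le_antisym c)
      have "\<phi> i k x \<sqsubseteq>\<^bsub>D k\<^esub> \<phi> i k x \<sqinter>\<^bsub>D k\<^esub> \<phi> i k y" "\<phi> i k y \<sqsubseteq>\<^bsub>D k\<^esub> \<phi> i k x \<sqinter>\<^bsub>D k\<^esub> \<phi> i k y"
        using c le k.le_trans[OF k.join_left[OF c]] k.le_trans[OF k.join_right[OF c]] by simp_all
      then show "\<phi> i k x \<sqsubseteq>\<^bsub>D k\<^esub> \<phi> i k y" "\<phi> i k y \<sqsubseteq>\<^bsub>D k\<^esub> \<phi> i k x"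
        using c k.le_trans[OF _ k.meet_left[OF c]] k.le_trans[OF _ k.meet_right[OF c]] by simp_all
    qed
    then show "X = Y" using i k by (auto simp: limit_map_eq_iff)
  next
    fix X Y Z assume *: "X \<sqsubseteq>\<^bsub>Lim\<^esub> Y" "Y \<sqsubseteq>\<^bsub>Lim\<^esub> Z" "X \<in> carrier Lim" "Y \<in> carrier Lim" "Z \<in> carrier Lim"
    obtain i x y where i: "i \<in> carrier I" "x \<in> carrier (D i)" "y \<in> carrier (D i)" "X = \<iota> i x" "Y = \<iota> i y"
      using * limit_carrier2E by metis
    obtain j z where j: "j \<in> carrier I" "z \<in> carrier (D j)" "Z = \<iota> j z" using * limit_carrierE by metis
    obtain k l where kl: "k \<in> carrier I" "i \<sqsubseteq>\<^bsub>I\<^esub> k" "\<phi> i k x \<sqsubseteq>\<^bsub>D k\<^esub> \<phi> i k y"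
      "l \<in> carrier I" "i \<sqsubseteq>\<^bsub>I\<^esub> l" "j \<sqsubseteq>\<^bsub>I\<^esub> l" "\<phi> i l y \<sqsubseteq>\<^bsub>D l\<^esub> \<phi> j l z"
      using * i j limit_le_iff by auto
    obtain n where n: "n \<in> carrier I" "k \<sqsubseteq>\<^bsub>I\<^esub> n" "l \<sqsubseteq>\<^bsub>I\<^esub> n" using index_directed kl by blast
    have le: "i \<sqsubseteq>\<^bsub>I\<^esub> n" "j \<sqsubseteq>\<^bsub>I\<^esub> n" using index_trans kl n i j by blast+
    interpret n: lattice "D n" using lattice n by blast
    have "\<phi> k n (\<phi> i k x) \<sqsubseteq>\<^bsub>D n\<^esub> \<phi> k n (\<phi> i k y)" "\<phi> l n (\<phi> i l y) \<sqsubseteq>\<^bsub>D n\<^esub> \<phi> l n (\<phi> j l z)"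
      using kl n i j map_mono[of k n "\<phi> i k x" "\<phi> i k y"] map_mono[of l n "\<phi> i l y" "\<phi> j l z"]
      by (simp_all add: map_closed)
    then have "\<phi> i n x \<sqsubseteq>\<^bsub>D n\<^esub> \<phi> i n y" "\<phi> i n y \<sqsubseteq>\<^bsub>D n\<^esub> \<phi> j n z"
      using kl n i j by (simp_all add: map_comp)
    then have "\<phi> i n x \<sqsubseteq>\<^bsub>D n\<^esub> \<phi> j n z"
      using n.le_trans[of "\<phi> i n x" "\<phi> i n y" "\<phi> j n z"] map_closed le n(1) i j by simp
    then show "X \<sqsubseteq>\<^bsub>Lim\<^esub> Z" using i j n le by (simp add: limit_le_iff) blast
  qed
qed

theorem lattice_limit: "lattice Lim"
proof -
  interpret partial_order Lim by (rule partial_order_limit)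
  show ?thesis
  proof unfold_locales
    fix X Y assume "X \<in> carrier Lim" "Y \<in> carrier Lim"
    then obtain i x y where i: "i \<in> carrier I" "x \<in> carrier (D i)" "y \<in> carrier (D i)" "X = \<iota> i x" "Y = \<iota> i y"
      by (rule limit_carrier2E)
    interpret i: lattice "D i" using lattice i by blast
    have "least Lim (\<iota> i (x \<squnion>\<^bsub>D i\<^esub> y)) (Upper Lim {X, Y})"
      using i limit_map_closed
      by (intro least_UpperI)
        (auto intro!: limit_map_mono limit_join_le i.join_left i.join_right simp: Upper_def)
    then show "\<exists>s. least Lim s (Upper Lim {X, Y})" by blast
    have "greatest Lim (\<iota> i (x \<sqinter>\<^bsub>D i\<^esub> y)) (Lower Lim {X, Y})"
      using i limit_map_closed
      by (intro greatest_LowerI)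
        (auto intro!: limit_map_mono limit_le_meet i.meet_left i.meet_right simp: Lower_def)
    then show "\<exists>s. greatest Lim s (Lower Lim {X, Y})" by blast
  qed
qed

lemma limit_join:
  assumes "i \<in> carrier I" "x \<in> carrier (D i)" "y \<in> carrier (D i)"
  shows "\<iota> i x \<squnion>\<^bsub>Lim\<^esub> \<iota> i y = \<iota> i (x \<squnion>\<^bsub>D i\<^esub> y)"
proof -
  interpret i: lattice "D i" using lattice assms by blast
  show ?thesis using assms
    by (intro joinI_lub lattice_limit limit_map_closed limit_map_mono limit_join_le
        i.join_closed i.join_left i.join_right)
qed

lemma limit_meet:
  assumes "i \<in> carrier I" "x \<in> carrier (D i)" "y \<in> carrier (D i)"
  shows "\<iota> i x \<sqinter>\<^bsub>Lim\<^esub> \<iota> i y = \<iota> i (x \<sqinter>\<^bsub>D i\<^esub> y)"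
proof -
  interpret i: lattice "D i" using lattice assms by blast
  show ?thesis using assms
    by (intro meetI_glb lattice_limit limit_map_closed limit_map_mono limit_le_meet
        i.meet_closed i.meet_left i.meet_right)
qed

lemma limit_map_hom: "i \<in> carrier I \<Longrightarrow> \<iota> i \<in> lattice_hom (D i) Lim"
  using limit_map_closed lattice lattice_limit limit_join limit_meet
  by (auto simp: lattice_hom_def join_pres_def meet_pres_def)

text \<open>
  Together with \<open>limit_map_hom\<close> and \<open>limit_map_compat\<close>: the direct limit is the colimit of the
  system in the category of lattices.
\<close>

theorem limit_universal:
  fixes M :: "'c gorder"
  assumes "lattice M" and g: "\<And>i. i \<in> carrier I \<Longrightarrow> g i \<in> lattice_hom (D i) M"
    and comp: "\<And>i j x. \<lbrakk>i \<in> carrier I; j \<in> carrier I; i \<sqsubseteq>\<^bsub>I\<^esub> j; x \<in> carrier (D i)\<rbrakk> \<Longrightarrow> g j (\<phi> i j x) = g i x"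
  shows "\<exists>h\<in>lattice_hom Lim M. \<forall>i\<in>carrier I. \<forall>x\<in>carrier (D i). h (\<iota> i x) = g i x"
    and "\<And>h h'. \<lbrakk>h \<in> lattice_hom Lim M; h' \<in> lattice_hom Lim M;
        \<forall>i\<in>carrier I. \<forall>x\<in>carrier (D i). h (\<iota> i x) = g i x;
        \<forall>i\<in>carrier I. \<forall>x\<in>carrier (D i). h' (\<iota> i x) = g i x\<rbrakk>
      \<Longrightarrow> \<forall>X\<in>carrier Lim. h X = h' X"
proof -
  define h where "h X = (SOME m. \<exists>i\<in>carrier I. \<exists>x\<in>carrier (D i). X = \<iota> i x \<and> m = g i x)" for X
  have wd: "g i x = g j y"
    if ij: "i \<in> carrier I" "x \<in> carrier (D i)" "j \<in> carrier I" "y \<in> carrier (D j)" "\<iota> i x = \<iota> j y" for i x j y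
  proof -
    obtain k where "k \<in> carrier I" "i \<sqsubseteq>\<^bsub>I\<^esub> k" "j \<sqsubseteq>\<^bsub>I\<^esub> k" "\<phi> i k x = \<phi> j k y"
      using ij(5) limit_map_eq_iff[OF ij(1-4)] by blast
    then show ?thesis using comp[of i k x] comp[of j k y] ij(1-4) by simp
  qed
  have h: "h (\<iota> i x) = g i x" if "i \<in> carrier I" "x \<in> carrier (D i)" for i x
    unfolding h_def
  proof (rule some_equality)
    show "\<exists>j\<in>carrier I. \<exists>y\<in>carrier (D j). \<iota> i x = \<iota> j y \<and> g i x = g j y"
      using that by blast
    fix m assume "\<exists>j\<in>carrier I. \<exists>y\<in>carrier (D j). \<iota> i x = \<iota> j y \<and> m = g j y"
    then obtain j y where "j \<in> carrier I" "y \<in> carrier (D j)" "\<iota> i x = \<iota> j y" "m = g j y"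
      by blast
    then show "m = g i x" using wd[of i x j y] that by simp
  qed
  have gc: "g i x \<in> carrier M" if "i \<in> carrier I" "x \<in> carrier (D i)" for i x
    using g[of i] that by (auto simp: lattice_hom_def)
  have "h \<in> carrier Lim \<rightarrow> carrier M"
    using h gc by (auto elim!: limit_carrierE)
  moreover have "h (X \<squnion>\<^bsub>Lim\<^esub> Y) = h X \<squnion>\<^bsub>M\<^esub> h Y \<and> h (X \<sqinter>\<^bsub>Lim\<^esub> Y) = h X \<sqinter>\<^bsub>M\<^esub> h Y"
    if "X \<in> carrier Lim" "Y \<in> carrier Lim" for X Y
  proof -
    obtain i x y where i: "i \<in> carrier I" "x \<in> carrier (D i)" "y \<in> carrier (D i)" "X = \<iota> i x" "Y = \<iota> i y"
      using \<open>X \<in> carrier Lim\<close> \<open>Y \<in> carrier Lim\<close> by (rule limit_carrier2E)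
    interpret i: lattice "D i" using lattice i by blast
    show ?thesis using i g[of i]
      by (simp add: limit_join limit_meet h) (simp add: lattice_hom_def join_pres_def meet_pres_def)
  qed
  ultimately have "h \<in> lattice_hom Lim M"
    using lattice_limit \<open>lattice M\<close> by (auto simp: lattice_hom_def join_pres_def meet_pres_def)
  then show "\<exists>h\<in>lattice_hom Lim M. \<forall>i\<in>carrier I. \<forall>x\<in>carrier (D i). h (\<iota> i x) = g i x"
    using h by blast
  fix h h' assume "\<forall>i\<in>carrier I. \<forall>x\<in>carrier (D i). h (\<iota> i x) = g i x"
        "\<forall>i\<in>carrier I. \<forall>x\<in>carrier (D i). h' (\<iota> i x) = g i x"
  then show "\<forall>X\<in>carrier Lim. h X = h' X" by (auto elim!: limit_carrierE)
qed

end

end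

theory Submission
  imports Defs
begin

text \<open>
  The step relation \<open>x \<lessdot>\<^sub>c y\<close> speaks only of joins and meets and of an upper bound, so
  homomorphisms preserve it, and it is reflexive, so that admitting chains of length zero does not
  change property (C). Under sectional or relative complementation a single step suffices, its
  witness being a complement of \<open>a\<close> in \<open>[\<bottom>, b]\<close> or in \<open>[a \<sqinter> c, b]\<close>. In an atomistic lattice, joining
  to \<open>a\<close> one after the other the atoms whose join is \<open>b\<close> is a chain of steps, because an atom either
  lies below an element or meets it in \<open>\<bottom>\<close>. In a direct limit, \<open>a\<close>, \<open>b\<close> and \<open>c\<close> come from a single
  stage, and a chain found there is carried to the limit.

  The join of two congruences is the transitive closure of their union (\<open>cong_join_eq_trancl\<close>).
  Hence \<open>\<Theta>(a,b) \<subseteq> \<alpha>\<^sub>0 \<or> \<alpha>\<^sub>1\<close> means that a finite path leads from \<open>a\<close> to \<open>b\<close>, each edge of which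
  lies in \<open>\<alpha>\<^sub>0\<close> or in \<open>\<alpha>\<^sub>1\<close>. Let \<open>v\<close> split over \<open>a\<close> if \<open>v = x\<^sub>0 \<squnion> x\<^sub>1\<close> with each \<open>x\<^sub>i\<close> above \<open>a\<close> and
  congruent to \<open>a\<close> modulo \<open>\<alpha>\<^sub>i\<close>. The congruence splitting of lattices with property (C) comes down to
  one step \<open>v \<lessdot>\<^sub>a w\<close> whose ends are congruent modulo \<open>\<alpha>\<^sub>i\<close>: if \<open>v\<close> splits, so does \<open>w\<close>
  (\<open>splits_over_lessdot\<close>). Property (C) with \<open>c = a\<close> cuts every move upwards inside a congruence class
  into such steps. Walking along the path, cut down to \<open>b\<close> and accumulated by joins, turns the
  splitting of \<open>a\<close> into one of \<open>b\<close>.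

  A path in a direct limit has finitely many vertices, so it is the image of a path at a single
  stage, between the congruences pulled back to that stage (\<open>lift_path\<close>). A splitting found there is
  mapped to one in the limit.
\<close>

section \<open>Chains of steps\<close>

definition lessdot_step :: "'a gorder \<Rightarrow> 'a \<Rightarrow> 'a \<Rightarrow> 'a \<Rightarrow> bool"
  where "lessdot_step L c x y \<longleftrightarrow> x \<in> carrier L \<and> y \<in> carrier L \<and> lessdot L c x y"

lemma lattice_hom_props:
  assumes "h \<in> lattice_hom L M"
  shows "lattice L" "lattice M"
    and "x \<in> carrier L \<Longrightarrow> h x \<in> carrier M"
    and "\<lbrakk>x \<in> carrier L; y \<in> carrier L\<rbrakk> \<Longrightarrow> h (x \<squnion>\<^bsub>L\<^esub> y) = h x \<squnion>\<^bsub>M\<^esub> h y"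
    and "\<lbrakk>x \<in> carrier L; y \<in> carrier L\<rbrakk> \<Longrightarrow> h (x \<sqinter>\<^bsub>L\<^esub> y) = h x \<sqinter>\<^bsub>M\<^esub> h y"
  using assms by (auto simp: lattice_hom_def join_pres_def meet_pres_def)

lemma lessdot_step_hom:
  assumes h: "h \<in> lattice_hom L M" and c: "c \<in> carrier L" and step: "lessdot_step L c x y"
  shows "lessdot_step M (h c) (h x) (h y)"
proof -
  interpret L: lattice L using lattice_hom_props(1)[OF h] .
  from step obtain u where u: "x \<in> carrier L" "y \<in> carrier L" "u \<in> carrier L"
    "x \<squnion>\<^bsub>L\<^esub> u = y" "x \<sqinter>\<^bsub>L\<^esub> u \<sqsubseteq>\<^bsub>L\<^esub> c"
    by (auto simp: lessdot_step_def lessdot_def)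
  have "h x \<squnion>\<^bsub>M\<^esub> h u = h y" using u lattice_hom_props(4)[OF h, of x u] by simp
  moreover have "h x \<sqinter>\<^bsub>M\<^esub> h u \<sqsubseteq>\<^bsub>M\<^esub> h c"
    using u c lattice_hom_props(5)[OF h, of x u] lattice_hom_mono[OF h _ c u(5)] by simp
  ultimately show ?thesis
    using u lattice_hom_props(3)[OF h] by (auto simp: lessdot_step_def lessdot_def)
qed

text \<open>Read as a transitive closure, a chain can be built and followed by induction.\<close>

lemma property_C_iff_tranclp:
  "property_C L \<longleftrightarrow> (\<forall>a\<in>carrier L. \<forall>b\<in>carrier L. \<forall>c\<in>carrier L. a \<sqsubseteq>\<^bsub>L\<^esub> b \<longrightarrow>
    (lessdot_step L c)\<^sup>+\<^sup>+ a b)"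
proof -
  have "(lessdot_step L c)\<^sup>+\<^sup>+ a b \<longleftrightarrow>
      (\<exists>n::nat. \<exists>x. 0 < n \<and> (\<forall>i\<le>n. x i \<in> carrier L) \<and> x 0 = a \<and> x n = b \<and>
        (\<forall>i<n. lessdot L c (x i) (x (Suc i))))"
    if "b \<in> carrier L" for a b c
  proof -
    have *: "(\<forall>i<n. lessdot_step L c (x i) (x (Suc i))) \<longleftrightarrow>
        (\<forall>i\<le>n. x i \<in> carrier L) \<and> (\<forall>i<n. lessdot L c (x i) (x (Suc i)))"
      if "x n = b" for n :: nat and x
      using that \<open>b \<in> carrier L\<close> unfolding lessdot_step_def
      by (auto simp: le_less) (metis Suc_leI le_neq_implies_less)
    have "(lessdot_step L c)\<^sup>+\<^sup>+ a b \<longleftrightarrow>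
        (\<exists>n x. 0 < n \<and> x 0 = a \<and> x n = b \<and> (\<forall>i<n. lessdot_step L c (x i) (x (Suc i))))"
      by (simp add: tranclp_power relpowp_fun_conv)
    also have "\<dots> \<longleftrightarrow> (\<exists>n::nat. \<exists>x. 0 < n \<and> (\<forall>i\<le>n. x i \<in> carrier L) \<and> x 0 = a \<and> x n = b \<and>
        (\<forall>i<n. lessdot L c (x i) (x (Suc i))))"
    proof (intro iff_exI)
      fix n x
      show "(0 < n \<and> x 0 = a \<and> x n = b \<and> (\<forall>i<n. lessdot_step L c (x i) (x (Suc i)))) \<longleftrightarrow>
        (0 < n \<and> (\<forall>i\<le>n. x i \<in> carrier L) \<and> x 0 = a \<and> x n = b \<and>
        (\<forall>i<n. lessdot L c (x i) (x (Suc i))))"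
        using *[of x n] by blast
    qed
    finally show ?thesis .
  qed
  then show ?thesis unfolding property_C_def by simp
qed

context lattice
begin

lemma join_absorb: "\<lbrakk>x \<in> carrier L; y \<in> carrier L; y \<sqsubseteq> x\<rbrakk> \<Longrightarrow> x \<squnion> y = x"
  using le_iff_meet join_comm by metis

lemma meet_absorb: "\<lbrakk>x \<in> carrier L; y \<in> carrier L; x \<sqsubseteq> y\<rbrakk> \<Longrightarrow> x \<sqinter> y = x"
  using le_iff_join by metis

lemma join_assoc:
  "\<lbrakk>x \<in> carrier L; y \<in> carrier L; z \<in> carrier L\<rbrakk> \<Longrightarrow> (x \<squnion> y) \<squnion> z = x \<squnion> (y \<squnion> z)"
  using weak_join_assoc by (simp add: eq_is_equal)

end

text \<open>
  Inside \<^locale>\<open>lattice\<close> the type of \<open>L\<close> is an arbitrary record extension, whereas the notions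
  considered here live on \<^typ>\<open>'a gorder\<close>.
\<close>

locale gorder_lattice = lattice L for L :: "'a gorder" (structure)
begin

text \<open>The witness \<open>x \<sqinter> c\<close> adds nothing to \<open>x\<close> and stays below \<open>c\<close>.\<close>

lemma lessdot_step_refl:
  assumes "x \<in> carrier L" "c \<in> carrier L"
  shows "lessdot_step L c x x"
proof -
  have "x \<squnion> (x \<sqinter> c) = x" using assms by (simp add: join_absorb meet_left)
  moreover have "x \<sqinter> (x \<sqinter> c) \<sqsubseteq> c"
    using assms le_trans[OF meet_right[of x "x \<sqinter> c"] meet_right[of x c]] by simp
  ultimately show ?thesis
    using assms by (auto simp: lessdot_step_def lessdot_def intro!: bexI[of _ "x \<sqinter> c"])
qed

lemma property_CI:
  assumes "\<And>a b c. \<lbrakk>a \<in> carrier L; b \<in> carrier L; c \<in> carrier L; a \<sqsubseteq> b\<rbrakk>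
    \<Longrightarrow> (lessdot_step L c)\<^sup>*\<^sup>* a b"
  shows "property_C L"
  unfolding property_C_iff_tranclp
  using assms lessdot_step_refl by (metis rtranclp_into_tranclp2)

section \<open>Complemented and atomistic lattices\<close>

lemma relatively_complemented_property_C:
  assumes "relatively_complemented L"
  shows "property_C L"
proof (rule property_CI)
  fix a b c assume abc: "a \<in> carrier L" "b \<in> carrier L" "c \<in> carrier L" "a \<sqsubseteq> b"
  have "a \<sqinter> c \<sqsubseteq> b" using abc le_trans[OF meet_left[of a c], of b] by simp
  then have "complemented_interval L (a \<sqinter> c) b" "a \<in> \<lbrace>a \<sqinter> c..b\<rbrace>"
    using assms abc meet_left[of a c]
    by (simp_all add: relatively_complemented_def at_least_at_most_def)
  then obtain y where "y \<in> carrier L" "a \<sqinter> y = a \<sqinter> c" "a \<squnion> y = b"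
    unfolding complemented_interval_def at_least_at_most_def by blast
  then have "lessdot_step L c a b"
    using abc meet_right[of a c] by (auto simp: lessdot_step_def lessdot_def)
  then show "(lessdot_step L c)\<^sup>*\<^sup>* a b" by blast
qed

lemma sectionally_complemented_property_C:
  assumes "sectionally_complemented L"
  shows "property_C L"
proof (rule property_CI)
  interpret bot: weak_partial_order_bottom L
    using assms by (simp add: sectionally_complemented_def)
  fix a b c assume abc: "a \<in> carrier L" "b \<in> carrier L" "c \<in> carrier L" "a \<sqsubseteq> b"
  then have "complemented_interval L \<bottom> b" "a \<in> \<lbrace>\<bottom>..b\<rbrace>"
    using assms by (simp_all add: sectionally_complemented_def at_least_at_most_def)
  then obtain y where "y \<in> carrier L" "a \<sqinter> y = \<bottom>" "a \<squnion> y = b"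
    unfolding complemented_interval_def at_least_at_most_def by blast
  then have "lessdot_step L c a b"
    using abc by (auto simp: lessdot_step_def lessdot_def)
  then show "(lessdot_step L c)\<^sup>*\<^sup>* a b" by blast
qed

lemma lessdot_step_atom:
  assumes "weak_partial_order_bottom L" and p: "lattice_atom L p"
    and a: "a \<in> carrier L" "c \<in> carrier L"
  shows "lessdot_step L c a (a \<squnion> p)"
proof -
  interpret bot: weak_partial_order_bottom L by fact
  have pc: "p \<in> carrier L" using p by (simp add: lattice_atom_def)
  show ?thesis
  proof (cases "a \<sqinter> p = \<bottom>")
    case True
    then show ?thesis using a pc by (auto simp: lessdot_step_def lessdot_def)
  next
    case False
    then have "a \<sqinter> p = p" using p a pc by (simp add: lattice_atom_def meet_right)
    then have "a \<squnion> p = a" using meet_left[of a p] a pc by (simp add: join_absorb)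
    then show ?thesis using lessdot_step_refl a by simp
  qed
qed

text \<open>
  Starting the induction from an arbitrary \<open>a\<close> keeps track of the suprema of \<open>insert a A\<close>, which
  exist for every finite \<open>A\<close>, the empty one included.
\<close>

lemma lessdot_chain_to_join_of_atoms:
  assumes bot: "weak_partial_order_bottom L" and fin: "finite A"
    and atoms: "A \<subseteq> {p. lattice_atom L p}" and a: "a \<in> carrier L" "c \<in> carrier L"
  shows "\<exists>d. (lessdot_step L c)\<^sup>*\<^sup>* a d \<and> least L d (Upper L (insert a A))"
  using fin atoms
proof (induction A)
  case empty
  then show ?case using sup_of_singletonI a by blast
next
  case (insert p A)
  then obtain d where d: "(lessdot_step L c)\<^sup>*\<^sup>* a d" "least L d (Upper L (insert a A))" by auto
  have p: "lattice_atom L p" "p \<in> carrier L" and A: "insert a A \<subseteq> carrier L"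
    using insert.prems a by (auto simp: lattice_atom_def)
  have dc: "d \<in> carrier L" using d by simp
  have "least L (d \<squnion> p) (Upper L (insert a (insert p A)))"
  proof (rule least_UpperI)
    fix x assume "x \<in> insert a (insert p A)"
    then consider "x = p" | "x \<in> insert a A" by blast
    then show "x \<sqsubseteq> d \<squnion> p"
    proof cases
      case 2
      then show ?thesis
        using least_Upper_above[OF d(2) 2 A] A dc p le_trans[OF _ join_left[OF dc p(2)], of x]
        by auto
    qed (use dc p join_right in simp)
  next
    fix y assume "y \<in> Upper L (insert a (insert p A))"
    then have y: "y \<in> Upper L (insert a A)" "p \<sqsubseteq> y" "y \<in> carrier L"
      using p by (auto simp: Upper_def)
    then show "d \<squnion> p \<sqsubseteq> y" using join_le least_le[OF d(2)] dc p by blast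
  qed (use A p dc in auto)
  moreover have "lessdot_step L c d (d \<squnion> p)"
    using lessdot_step_atom[OF bot p(1) dc a(2)] .
  ultimately show ?case using d(1) by (meson rtranclp.rtrancl_into_rtrancl)
qed

lemma atomistic_property_C:
  assumes "atomistic L"
  shows "property_C L"
proof (rule property_CI)
  interpret bot: weak_partial_order_bottom L
    using assms by (simp add: atomistic_def)
  fix a b c assume abc: "a \<in> carrier L" "b \<in> carrier L" "c \<in> carrier L" "a \<sqsubseteq> b"
  obtain A where A: "finite A" "A \<subseteq> {p. lattice_atom L p}" "b = \<Squnion>A"
    using assms abc(2) unfolding atomistic_def by blast
  obtain d where d: "(lessdot_step L c)\<^sup>*\<^sup>* a d" "least L d (Upper L (insert a A))"
    using lessdot_chain_to_join_of_atoms[OF bot.weak_partial_order_bottom_axioms A(1,2) abc(1,3)]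
    by blast
  have Ac: "A \<subseteq> carrier L" using A by (auto simp: lattice_atom_def)
  have b: "least L b (Upper L A)"
  proof (cases "A = {}")
    case True
    then show ?thesis using A(3) bot.bottom_least by (simp add: Sup_empty_eq_bottom)
  next
    case False
    then show ?thesis using A Ac finite_sup_least by blast
  qed
  have "least L b (Upper L (insert a A))"
  proof (rule least_UpperI)
    show "x \<sqsubseteq> b" if "x \<in> insert a A" for x
      using that abc least_Upper_above[OF b _ Ac] by blast
    show "b \<sqsubseteq> y" if "y \<in> Upper L (insert a A)" for y
      using that least_le[OF b] Upper_antimono[of A "insert a A" L] by blast
  qed (use abc Ac in auto)
  then have "d = b" using d least_unique by blast
  then show "(lessdot_step L c)\<^sup>*\<^sup>* a b" using d by simp
qed

end

section \<open>Joins of congruences\<close>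

lemma lattice_congruenceD:
  assumes "lattice_congruence L \<theta>"
  shows "equiv (carrier L) \<theta>"
    and "(x, y) \<in> \<theta> \<Longrightarrow> x \<in> carrier L" "(x, y) \<in> \<theta> \<Longrightarrow> y \<in> carrier L"
    and "x \<in> carrier L \<Longrightarrow> (x, x) \<in> \<theta>"
    and "(x, y) \<in> \<theta> \<Longrightarrow> (y, x) \<in> \<theta>"
    and "\<lbrakk>(x, y) \<in> \<theta>; (y, z) \<in> \<theta>\<rbrakk> \<Longrightarrow> (x, z) \<in> \<theta>"
    and "\<lbrakk>(x, x') \<in> \<theta>; (y, y') \<in> \<theta>\<rbrakk> \<Longrightarrow> (x \<squnion>\<^bsub>L\<^esub> y, x' \<squnion>\<^bsub>L\<^esub> y') \<in> \<theta>"
    and "\<lbrakk>(x, x') \<in> \<theta>; (y, y') \<in> \<theta>\<rbrakk> \<Longrightarrow> (x \<sqinter>\<^bsub>L\<^esub> y, x' \<sqinter>\<^bsub>L\<^esub> y') \<in> \<theta>"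
proof -
  show e: "equiv (carrier L) \<theta>" using assms by (simp add: lattice_congruence_def)
  show "(x, y) \<in> \<theta> \<Longrightarrow> x \<in> carrier L" "(x, y) \<in> \<theta> \<Longrightarrow> y \<in> carrier L"
    using equiv_type[OF e] by auto
  show "x \<in> carrier L \<Longrightarrow> (x, x) \<in> \<theta>" using e by (auto simp: equiv_def refl_on_def)
  show "(x, y) \<in> \<theta> \<Longrightarrow> (y, x) \<in> \<theta>" using e by (auto simp: equiv_def dest: symD)
  show "\<lbrakk>(x, y) \<in> \<theta>; (y, z) \<in> \<theta>\<rbrakk> \<Longrightarrow> (x, z) \<in> \<theta>" using e by (auto simp: equiv_def dest: transD)
qed (use assms in \<open>auto simp: lattice_congruence_def\<close>)

text \<open>
  By commutativity a translation moves either argument, and the two moves compose by transitivity.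
\<close>

lemma lattice_congruenceI:
  assumes e: "equiv (carrier L) \<theta>"
    and join: "\<And>x y z. \<lbrakk>(x, y) \<in> \<theta>; z \<in> carrier L\<rbrakk> \<Longrightarrow> (x \<squnion>\<^bsub>L\<^esub> z, y \<squnion>\<^bsub>L\<^esub> z) \<in> \<theta>"
    and meet: "\<And>x y z. \<lbrakk>(x, y) \<in> \<theta>; z \<in> carrier L\<rbrakk> \<Longrightarrow> (x \<sqinter>\<^bsub>L\<^esub> z, y \<sqinter>\<^bsub>L\<^esub> z) \<in> \<theta>"
  shows "lattice_congruence L \<theta>"
  unfolding lattice_congruence_def
proof (intro conjI allI impI e)
  fix x x' y y' assume *: "(x, x') \<in> \<theta>" "(y, y') \<in> \<theta>"
  then have c: "x' \<in> carrier L" "y \<in> carrier L" using equiv_type[OF e] by auto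
  have trans: "\<And>u v w. (u, v) \<in> \<theta> \<Longrightarrow> (v, w) \<in> \<theta> \<Longrightarrow> (u, w) \<in> \<theta>"
    using e by (auto simp: equiv_def dest: transD)
  show "(x \<squnion>\<^bsub>L\<^esub> y, x' \<squnion>\<^bsub>L\<^esub> y') \<in> \<theta>"
    using trans[OF join[OF *(1) c(2)]] join[OF *(2) c(1)] by (simp add: join_comm[of L x'])
  show "(x \<sqinter>\<^bsub>L\<^esub> y, x' \<sqinter>\<^bsub>L\<^esub> y') \<in> \<theta>"
    using trans[OF meet[OF *(1) c(2)]] meet[OF *(2) c(1)] by (simp add: meet_comm[of L x'])
qed

lemma trancl_map_closed:
  assumes "(x, y) \<in> R\<^sup>+" and "\<And>u v. (u, v) \<in> R \<Longrightarrow> (f u, f v) \<in> S"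
  shows "(f x, f y) \<in> S\<^sup>+"
  using assms(1) by induction (auto intro: assms(2) trancl.intros)

lemma lattice_congruence_trancl_Un:
  assumes \<alpha>: "lattice_congruence L \<alpha>" and \<beta>: "lattice_congruence L \<beta>"
  shows "lattice_congruence L ((\<alpha> \<union> \<beta>)\<^sup>+)"
proof (rule lattice_congruenceI)
  note A = lattice_congruenceD[OF \<alpha>] and B = lattice_congruenceD[OF \<beta>]
  have "\<alpha> \<union> \<beta> \<subseteq> carrier L \<times> carrier L" using A(2,3) B(2,3) by auto
  moreover have "sym (\<alpha> \<union> \<beta>)" using A(5) B(5) by (auto intro!: symI)
  moreover have "refl_on (carrier L) ((\<alpha> \<union> \<beta>)\<^sup>+)" using A(4) by (auto simp: refl_on_def)
  ultimately show "equiv (carrier L) ((\<alpha> \<union> \<beta>)\<^sup>+)"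
    by (intro equivI trancl_subset_Sigma sym_trancl trans_trancl)
  show "(x \<squnion>\<^bsub>L\<^esub> z, y \<squnion>\<^bsub>L\<^esub> z) \<in> (\<alpha> \<union> \<beta>)\<^sup>+" if "(x, y) \<in> (\<alpha> \<union> \<beta>)\<^sup>+" "z \<in> carrier L" for x y z
    using that(1) by (rule trancl_map_closed[where f = "\<lambda>u. u \<squnion>\<^bsub>L\<^esub> z"])
      (use A(4)[OF that(2)] B(4)[OF that(2)] in \<open>auto intro: A(7) B(7)\<close>)
  show "(x \<sqinter>\<^bsub>L\<^esub> z, y \<sqinter>\<^bsub>L\<^esub> z) \<in> (\<alpha> \<union> \<beta>)\<^sup>+" if "(x, y) \<in> (\<alpha> \<union> \<beta>)\<^sup>+" "z \<in> carrier L" for x y z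
    using that(1) by (rule trancl_map_closed[where f = "\<lambda>u. u \<sqinter>\<^bsub>L\<^esub> z"])
      (use A(4)[OF that(2)] B(4)[OF that(2)] in \<open>auto intro: A(8) B(8)\<close>)
qed

lemma cong_join_eq_trancl:
  assumes "lattice_congruence L \<alpha>" "lattice_congruence L \<beta>"
  shows "cong_join L \<alpha> \<beta> = (\<alpha> \<union> \<beta>)\<^sup>+"
proof
  show "cong_join L \<alpha> \<beta> \<subseteq> (\<alpha> \<union> \<beta>)\<^sup>+"
    unfolding cong_join_def cong_generated_def
    using lattice_congruence_trancl_Un[OF assms] by (auto intro: r_into_trancl)
  have "(\<alpha> \<union> \<beta>)\<^sup>+ \<subseteq> \<theta>" if "lattice_congruence L \<theta>" "\<alpha> \<union> \<beta> \<subseteq> \<theta>" for \<theta>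
  proof -
    have "trans \<theta>" using lattice_congruenceD(1)[OF that(1)] by (simp add: equiv_def)
    then show ?thesis using trancl_mono_subset[OF that(2)] by (simp add: trancl_id)
  qed
  then show "(\<alpha> \<union> \<beta>)\<^sup>+ \<subseteq> cong_join L \<alpha> \<beta>"
    unfolding cong_join_def cong_generated_def by blast
qed

lemma principal_cong_subset_iff:
  assumes "lattice_congruence L \<theta>"
  shows "principal_cong L u v \<subseteq> \<theta> \<longleftrightarrow> (u, v) \<in> \<theta>"
  using assms unfolding principal_cong_def cong_generated_def by blast

text \<open>A principal congruence is contained in a congruence as soon as its generating pair is.\<close>

lemma congruence_splitting_iff:
  "congruence_splitting L \<longleftrightarrow>
    (\<forall>a\<in>carrier L. \<forall>b\<in>carrier L. a \<sqsubseteq>\<^bsub>L\<^esub> b \<longrightarrow>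
      (\<forall>\<alpha> \<beta>. lattice_congruence L \<alpha> \<longrightarrow> lattice_congruence L \<beta> \<longrightarrow> (a, b) \<in> (\<alpha> \<union> \<beta>)\<^sup>+ \<longrightarrow>
        (\<exists>x\<in>\<lbrace>a..b\<rbrace>\<^bsub>L\<^esub>. \<exists>y\<in>\<lbrace>a..b\<rbrace>\<^bsub>L\<^esub>. x \<squnion>\<^bsub>L\<^esub> y = b \<and> (a, x) \<in> \<alpha> \<and> (a, y) \<in> \<beta>)))"
  unfolding congruence_splitting_def
  by (simp add: cong_join_eq_trancl principal_cong_subset_iff lattice_congruence_trancl_Un
      cong: conj_cong)

section \<open>Property (C) implies congruence splitting\<close>

text \<open>
  The bounds \<open>x \<sqsubseteq> v\<close> and \<open>y \<sqsubseteq> v\<close> follow from the join, and membership in the carrier from the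
  congruences, so this places \<open>x\<close> and \<open>y\<close> in \<open>[a, v]\<close>.
\<close>

definition splits_over :: "'a gorder \<Rightarrow> 'a rel \<Rightarrow> 'a rel \<Rightarrow> 'a \<Rightarrow> 'a \<Rightarrow> bool"
  where "splits_over L \<alpha> \<beta> a v \<longleftrightarrow> (\<exists>x y. a \<sqsubseteq>\<^bsub>L\<^esub> x \<and> a \<sqsubseteq>\<^bsub>L\<^esub> y \<and> (a, x) \<in> \<alpha> \<and> (a, y) \<in> \<beta> \<and>
    x \<squnion>\<^bsub>L\<^esub> y = v)"

lemma splits_over_commute: "splits_over L \<alpha> \<beta> a v \<longleftrightarrow> splits_over L \<beta> \<alpha> a v"
  unfolding splits_over_def using join_comm by metis

context gorder_lattice
begin

lemma lattice_congruence_convex: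
  assumes "lattice_congruence L \<theta>" "(u, w) \<in> \<theta>" "v \<in> carrier L" "u \<sqsubseteq> v" "v \<sqsubseteq> w"
  shows "(u, v) \<in> \<theta>"
proof -
  note D = lattice_congruenceD[OF assms(1)]
  have "(u \<sqinter> v, w \<sqinter> v) \<in> \<theta>" using D(8)[OF assms(2) D(4)[OF assms(3)]] .
  then show ?thesis
    using meet_absorb[of u v] meet_absorb[of v w] assms(3-5) D(2,3)[OF assms(2)]
    by (simp add: meet_comm[of L w])
qed

text \<open>
  Let \<open>x\<close> witness the step. Meeting \<open>v\<close> and \<open>w\<close> with \<open>x\<close> shows that \<open>x = w \<sqinter> x\<close> is congruent to
  \<open>v \<sqinter> x \<sqsubseteq> a\<close>. So \<open>a \<squnion> x\<close> is congruent to \<open>a\<close>, and \<open>x\<close> can be absorbed into the component of \<open>v\<close> that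
  belongs to \<open>\<alpha>\<close>.
\<close>

lemma splits_over_lessdot:
  assumes \<alpha>: "lattice_congruence L \<alpha>" and \<beta>: "lattice_congruence L \<beta>"
    and v: "splits_over L \<alpha> \<beta> a v" and step: "lessdot L a v w" and vw: "(v, w) \<in> \<alpha>"
  shows "splits_over L \<alpha> \<beta> a w"
proof -
  note A = lattice_congruenceD[OF \<alpha>] and B = lattice_congruenceD[OF \<beta>]
  obtain p q where pq: "a \<sqsubseteq> p" "a \<sqsubseteq> q" "(a, p) \<in> \<alpha>" "(a, q) \<in> \<beta>" "p \<squnion> q = v"
    using v by (auto simp: splits_over_def)
  obtain x where x: "x \<in> carrier L" "v \<squnion> x = w" "v \<sqinter> x \<sqsubseteq> a"
    using step by (auto simp: lessdot_def)
  have c: "a \<in> carrier L" "p \<in> carrier L" "q \<in> carrier L" "v \<in> carrier L" "w \<in> carrier L"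
    using A(2,3) B(3) pq vw by blast+
  have "w \<sqinter> x = x" using meet_absorb[of x w] join_right[of v x] x c by (simp add: meet_comm[of L w])
  then have "(v \<sqinter> x, x) \<in> \<alpha>" using A(8)[OF vw A(4)[OF x(1)]] by simp
  then have "(a \<squnion> (v \<sqinter> x), a \<squnion> x) \<in> \<alpha>" using A(7)[OF A(4)[OF c(1)]] by blast
  then have "(a, a \<squnion> x) \<in> \<alpha>" using x c by (simp add: join_absorb)
  then have "(a \<squnion> a, p \<squnion> (a \<squnion> x)) \<in> \<alpha>" using A(7)[OF pq(3)] by blast
  moreover have "p \<squnion> (a \<squnion> x) = p \<squnion> x"
    using join_assoc[of p a x] join_absorb[of p a] pq c x by simp
  ultimately have "(a, p \<squnion> x) \<in> \<alpha>" using c by (simp add: join_absorb)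
  moreover have "a \<sqsubseteq> p \<squnion> x" using le_trans[OF pq(1) join_left[of p x]] c x by simp
  moreover have "(p \<squnion> x) \<squnion> q = w"
    using join_assoc[of p x q] join_assoc[of p q x] join_comm[of L x q] pq c x by simp
  ultimately show ?thesis using pq unfolding splits_over_def by blast
qed

text \<open>
  A chain from \<open>v\<close> to \<open>w\<close> ascends within \<open>[v, w]\<close>, which lies in a single class of \<open>\<alpha>\<close> because
  congruence classes are convex.
\<close>

lemma splits_over_extend:
  assumes C: "property_C L" and \<alpha>: "lattice_congruence L \<alpha>" and \<beta>: "lattice_congruence L \<beta>"
    and v: "splits_over L \<alpha> \<beta> a v" and vw: "(v, w) \<in> \<alpha>" "v \<sqsubseteq> w"
  shows "splits_over L \<alpha> \<beta> a w"
proof -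
  note A = lattice_congruenceD[OF \<alpha>]
  have c: "a \<in> carrier L" "v \<in> carrier L" "w \<in> carrier L"
    using v A(2,3) vw by (auto simp: splits_over_def)
  have le: "y \<sqsubseteq> z" if "lessdot_step L a y z" for y z
    using that by (auto simp: lessdot_step_def lessdot_def join_left)
  have "(lessdot_step L a)\<^sup>*\<^sup>* v w"
    using C c vw unfolding property_C_iff_tranclp by (meson tranclp_into_rtranclp)
  then have "splits_over L \<alpha> \<beta> a v \<longrightarrow> splits_over L \<alpha> \<beta> a w" using vw
  proof (induction rule: converse_rtranclp_induct)
    case (step y z)
    have yz: "y \<in> carrier L" "z \<in> carrier L" using step.hyps by (auto simp: lessdot_step_def)
    have zw: "z \<sqsubseteq> w"
      using step.hyps(2) yz
      by (induction rule: rtranclp_induct)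
        (auto simp: lessdot_step_def lessdot_def intro: le_trans[OF _ join_left])
    have "(y, z) \<in> \<alpha>" using lattice_congruence_convex[OF \<alpha> step.prems(1) yz(2) le zw] step.hyps by blast
    moreover from this have "(z, w) \<in> \<alpha>" using A(5,6) step.prems by blast
    ultimately show ?case
      using splits_over_lessdot[OF \<alpha> \<beta>] step.hyps step.IH zw by (auto simp: lessdot_step_def)
  qed simp
  then show ?thesis using v by blast
qed

text \<open>
  Cutting each vertex of the path down to \<open>b\<close> keeps the split elements below \<open>b\<close>; a splitting
  of an element above \<open>b\<close> would be of no use, since meeting with \<open>b\<close> need not preserve joins.
\<close>

lemma splits_over_path:
  assumes C: "property_C L" and \<alpha>: "lattice_congruence L \<alpha>" and \<beta>: "lattice_congruence L \<beta>"
    and b: "b \<in> carrier L" "a \<sqsubseteq> b" and path: "(a, z) \<in> (\<alpha> \<union> \<beta>)\<^sup>*" and a: "a \<in> carrier L"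
  shows "\<exists>v. splits_over L \<alpha> \<beta> a v \<and> v \<in> carrier L \<and> v \<sqsubseteq> b \<and> z \<sqinter> b \<sqsubseteq> v"
  using path
proof induction
  case base
  have "splits_over L \<alpha> \<beta> a a"
    using a lattice_congruenceD(4)[OF \<alpha>] lattice_congruenceD(4)[OF \<beta>]
    unfolding splits_over_def by (intro exI[of _ a]) (simp add: join_absorb)
  then show ?case using a b meet_left by blast
next
  case (step y z)
  then obtain v where v: "splits_over L \<alpha> \<beta> a v" "v \<in> carrier L" "v \<sqsubseteq> b" "y \<sqinter> b \<sqsubseteq> v" by blast
  define w where "w = v \<squnion> (z \<sqinter> b)"
  have c: "y \<in> carrier L" "z \<in> carrier L"
    using step.hyps(2) lattice_congruenceD(2,3)[OF \<alpha>] lattice_congruenceD(2,3)[OF \<beta>] by blast+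
  have w: "w \<in> carrier L" "w \<sqsubseteq> b" "z \<sqinter> b \<sqsubseteq> w" "v \<sqsubseteq> w"
    using c v b by (auto simp: w_def join_left join_right meet_right intro: join_le)
  have vw: "(v, w) \<in> \<theta>" if "(y, z) \<in> \<theta>" and \<theta>: "lattice_congruence L \<theta>" for \<theta>
  proof -
    note D = lattice_congruenceD[OF \<theta>]
    have "(v \<squnion> (y \<sqinter> b), v \<squnion> (z \<sqinter> b)) \<in> \<theta>" using D(4,7,8) that b v by blast
    then show ?thesis using v c b by (simp add: w_def join_absorb)
  qed
  from step.hyps(2) have "splits_over L \<alpha> \<beta> a w"
  proof
    assume "(y, z) \<in> \<alpha>"
    then show ?thesis using splits_over_extend[OF C \<alpha> \<beta> v(1) vw[OF _ \<alpha>] w(4)] by blast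
  next
    assume "(y, z) \<in> \<beta>"
    then show ?thesis
      using splits_over_extend[OF C \<beta> \<alpha> _ vw[OF _ \<beta>] w(4)] v(1) splits_over_commute by metis
  qed
  then show ?case using w by blast
qed

lemma property_C_congruence_splitting:
  assumes "property_C L"
  shows "congruence_splitting L"
  unfolding congruence_splitting_iff
proof (intro ballI allI impI)
  fix a b \<alpha> \<beta>
  assume ab: "a \<in> carrier L" "b \<in> carrier L" "a \<sqsubseteq> b"
    and \<alpha>: "lattice_congruence L \<alpha>" and \<beta>: "lattice_congruence L \<beta>"
    and path: "(a, b) \<in> (\<alpha> \<union> \<beta>)\<^sup>+"
  obtain v where v: "splits_over L \<alpha> \<beta> a v" "v \<in> carrier L" "v \<sqsubseteq> b" "b \<sqinter> b \<sqsubseteq> v"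
    using splits_over_path[OF assms \<alpha> \<beta> ab(2,3) trancl_into_rtrancl[OF path] ab(1)] by blast
  then have "v = b" using ab by (simp add: meet_absorb le_antisym)
  then obtain x y where xy: "a \<sqsubseteq> x" "a \<sqsubseteq> y" "(a, x) \<in> \<alpha>" "(a, y) \<in> \<beta>" "x \<squnion> y = b"
    using v by (auto simp: splits_over_def)
  have "x \<in> carrier L" "y \<in> carrier L"
    using xy lattice_congruenceD(3)[OF \<alpha>] lattice_congruenceD(3)[OF \<beta>] by blast+
  then show "\<exists>x\<in>\<lbrace>a..b\<rbrace>. \<exists>y\<in>\<lbrace>a..b\<rbrace>. x \<squnion> y = b \<and> (a, x) \<in> \<alpha> \<and> (a, y) \<in> \<beta>"
    using xy join_left[of x y] join_right[of x y] by (auto simp: at_least_at_most_def)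
qed

end

section \<open>Direct limits\<close>

text \<open>
  What matters about a direct limit is that its stages are mapped compatibly to it and jointly cover
  it: then finitely many elements are represented at one stage, and relations pulled back to a stage
  depend only on images in the limit.
\<close>

locale covering_cocone = lattice_direct_system I D \<phi>
  for I :: "'i gorder" and D :: "'i \<Rightarrow> 'a gorder" and \<phi> +
  fixes M :: "'b gorder" and g :: "'i \<Rightarrow> 'a \<Rightarrow> 'b"
  assumes cocone_hom: "i \<in> carrier I \<Longrightarrow> g i \<in> lattice_hom (D i) M"
    and cocone_compat:
      "\<lbrakk>i \<in> carrier I; j \<in> carrier I; i \<sqsubseteq>\<^bsub>I\<^esub> j; x \<in> carrier (D i)\<rbrakk> \<Longrightarrow> g j (\<phi> i j x) = g i x"
    and cocone_covers: "z \<in> carrier M \<Longrightarrow> \<exists>i\<in>carrier I. \<exists>x\<in>carrier (D i). g i x = z"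
begin

lemma lattice_target: "lattice M"
  using index_nonempty cocone_hom lattice_hom_props(2) by blast

lemma later_representative:
  assumes "i \<in> carrier I" "z \<in> carrier M"
  obtains k x where "k \<in> carrier I" "i \<sqsubseteq>\<^bsub>I\<^esub> k" "x \<in> carrier (D k)" "g k x = z"
proof -
  obtain j x where j: "j \<in> carrier I" "x \<in> carrier (D j)" "g j x = z"
    using cocone_covers assms by blast
  obtain k where "k \<in> carrier I" "i \<sqsubseteq>\<^bsub>I\<^esub> k" "j \<sqsubseteq>\<^bsub>I\<^esub> k" using index_directed assms j by blast
  then show ?thesis using that[of k "\<phi> j k x"] j map_closed cocone_compat by simp
qed

text \<open>Comparable elements have comparable representatives: \<open>y\<close> can be replaced by \<open>x \<squnion> y\<close>.\<close>

lemma ordered_representative: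
  assumes "k \<in> carrier I" "x \<in> carrier (D k)" "y \<in> carrier (D k)" "g k x \<sqsubseteq>\<^bsub>M\<^esub> g k y"
  shows "x \<sqsubseteq>\<^bsub>D k\<^esub> x \<squnion>\<^bsub>D k\<^esub> y" "x \<squnion>\<^bsub>D k\<^esub> y \<in> carrier (D k)" "g k (x \<squnion>\<^bsub>D k\<^esub> y) = g k y"
proof -
  interpret k: lattice "D k" using lattice assms by blast
  interpret M: lattice M by (rule lattice_target)
  note h = lattice_hom_props[OF cocone_hom[OF assms(1)]]
  show "x \<sqsubseteq>\<^bsub>D k\<^esub> x \<squnion>\<^bsub>D k\<^esub> y" "x \<squnion>\<^bsub>D k\<^esub> y \<in> carrier (D k)" using assms k.join_left by auto
  show "g k (x \<squnion>\<^bsub>D k\<^esub> y) = g k y" using assms h M.le_iff_meet by simp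
qed

lemma property_C_target:
  assumes C: "\<And>i. i \<in> carrier I \<Longrightarrow> property_C (D i)"
  shows "property_C M"
proof (rule gorder_lattice.property_CI[OF gorder_lattice.intro, OF lattice_target])
  fix a b c assume abc: "a \<in> carrier M" "b \<in> carrier M" "c \<in> carrier M" "a \<sqsubseteq>\<^bsub>M\<^esub> b"
  obtain i x where i: "i \<in> carrier I" "x \<in> carrier (D i)" "g i x = a" using cocone_covers abc by blast
  obtain j y where j: "j \<in> carrier I" "i \<sqsubseteq>\<^bsub>I\<^esub> j" "y \<in> carrier (D j)" "g j y = b"
    using later_representative i abc by metis
  obtain k z where k: "k \<in> carrier I" "j \<sqsubseteq>\<^bsub>I\<^esub> k" "z \<in> carrier (D k)" "g k z = c"
    using later_representative j abc by metis
  define x' y' where "x' = \<phi> j k (\<phi> i j x)" and "y' = \<phi> j k y"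
  have x': "x' \<in> carrier (D k)" "g k x' = a" and y': "y' \<in> carrier (D k)" "g k y' = b"
    using i j k map_closed cocone_compat by (simp_all add: x'_def y'_def)
  note o = ordered_representative[OF k(1) x'(1) y'(1), unfolded x' y', OF abc(4)]
  have "(lessdot_step (D k) z)\<^sup>*\<^sup>* x' (x' \<squnion>\<^bsub>D k\<^esub> y')"
    using C[OF k(1)] x' k o unfolding property_C_iff_tranclp by (meson tranclp_into_rtranclp)
  then have "(lessdot_step M c)\<^sup>*\<^sup>* (g k x') (g k (x' \<squnion>\<^bsub>D k\<^esub> y'))"
  proof induction
    case (step u v)
    then show ?case
      using lessdot_step_hom[OF cocone_hom[OF k(1)] k(3)] k(4) by (metis rtranclp.rtrancl_into_rtrancl)
  qed simp
  then show "(lessdot_step M c)\<^sup>*\<^sup>* a b" using x' o by simp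
qed

definition pullback :: "'i \<Rightarrow> 'b rel \<Rightarrow> 'a rel"
  where "pullback i R = {(x, y). x \<in> carrier (D i) \<and> y \<in> carrier (D i) \<and> (g i x, g i y) \<in> R}"

lemma lattice_congruence_pullback:
  assumes "i \<in> carrier I" "lattice_congruence M \<theta>"
  shows "lattice_congruence (D i) (pullback i \<theta>)"
proof -
  interpret i: lattice "D i" using lattice assms by blast
  note h = lattice_hom_props[OF cocone_hom[OF assms(1)]] and D = lattice_congruenceD[OF assms(2)]
  have "equiv (carrier (D i)) (pullback i \<theta>)"
  proof (rule equivI)
    show "refl_on (carrier (D i)) (pullback i \<theta>)" using D(4) h(3) by (simp add: refl_on_def pullback_def)
    show "sym (pullback i \<theta>)" using D(5) by (simp add: sym_def pullback_def)
    show "trans (pullback i \<theta>)" using D(6) by (simp add: trans_def pullback_def) blast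
  qed (auto simp: pullback_def)
  then show ?thesis
    unfolding lattice_congruence_def using D(7,8) h by (auto simp: pullback_def)
qed

text \<open>
  By induction along the path: the next vertex may only be represented at a later stage, to which the
  part of the path found so far is transported by the transition map.
\<close>

lemma lift_path:
  assumes R: "R \<subseteq> carrier M \<times> carrier M" and path: "(a, b) \<in> R\<^sup>+"
  shows "\<exists>k\<in>carrier I. \<exists>x\<in>carrier (D k). \<exists>y\<in>carrier (D k).
    g k x = a \<and> g k y = b \<and> (x, y) \<in> (pullback k R)\<^sup>+"
  using path
proof induction
  case (base b)
  then obtain i x where i: "i \<in> carrier I" "x \<in> carrier (D i)" "g i x = a"
    using cocone_covers R by blast
  obtain k y where k: "k \<in> carrier I" "i \<sqsubseteq>\<^bsub>I\<^esub> k" "y \<in> carrier (D k)" "g k y = b"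
    using later_representative[OF i(1), of b] base R by blast
  have "\<phi> i k x \<in> carrier (D k)" "g k (\<phi> i k x) = a"
    using i k map_closed cocone_compat by auto
  then show ?case using k base by (auto simp: pullback_def intro!: bexI[of _ k])
next
  case (step b c)
  then obtain i x y where i: "i \<in> carrier I" "x \<in> carrier (D i)" "y \<in> carrier (D i)"
    "g i x = a" "g i y = b" "(x, y) \<in> (pullback i R)\<^sup>+" by blast
  obtain k z where k: "k \<in> carrier I" "i \<sqsubseteq>\<^bsub>I\<^esub> k" "z \<in> carrier (D k)" "g k z = c"
    using later_representative[OF i(1), of c] step.hyps R by blast
  have "(\<phi> i k x, \<phi> i k y) \<in> (pullback k R)\<^sup>+"
    by (rule trancl_map_closed[OF i(6)]) (use i k map_closed cocone_compat in \<open>auto simp: pullback_def\<close>)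
  moreover have "(\<phi> i k y, z) \<in> pullback k R"
    using i k step.hyps map_closed cocone_compat by (auto simp: pullback_def)
  ultimately have "(\<phi> i k x, z) \<in> (pullback k R)\<^sup>+" by (rule trancl.trancl_into_trancl)
  then show ?case using i k map_closed[of i k x] cocone_compat[of i k x] by (intro bexI[of _ k]) blast+
qed

lemma congruence_splitting_target:
  assumes split: "\<And>i. i \<in> carrier I \<Longrightarrow> congruence_splitting (D i)"
  shows "congruence_splitting M"
  unfolding congruence_splitting_iff
proof (intro ballI allI impI)
  fix a b \<alpha> \<beta>
  assume ab: "a \<in> carrier M" "b \<in> carrier M" "a \<sqsubseteq>\<^bsub>M\<^esub> b"
    and \<alpha>: "lattice_congruence M \<alpha>" and \<beta>: "lattice_congruence M \<beta>"
    and path: "(a, b) \<in> (\<alpha> \<union> \<beta>)\<^sup>+"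
  have "\<alpha> \<union> \<beta> \<subseteq> carrier M \<times> carrier M"
    using equiv_type[OF lattice_congruenceD(1)[OF \<alpha>]] equiv_type[OF lattice_congruenceD(1)[OF \<beta>]]
    by blast
  from lift_path[OF this path] obtain k x y where k: "k \<in> carrier I"
    and x: "x \<in> carrier (D k)" "g k x = a" and y: "y \<in> carrier (D k)" "g k y = b"
    and xy: "(x, y) \<in> (pullback k (\<alpha> \<union> \<beta>))\<^sup>+"
    by blast
  interpret k: lattice "D k" using lattice k by blast
  note h = lattice_hom_props[OF cocone_hom[OF k]] and mono = lattice_hom_mono[OF cocone_hom[OF k]]
  note cong = lattice_congruence_pullback[OF k \<alpha>] lattice_congruence_pullback[OF k \<beta>]
  have "pullback k (\<alpha> \<union> \<beta>) = pullback k \<alpha> \<union> pullback k \<beta>" by (auto simp: pullback_def)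
  then have "(x, y) \<in> (pullback k \<alpha> \<union> pullback k \<beta>)\<^sup>+" using xy by simp
  note D = lattice_congruenceD[OF lattice_congruence_trancl_Un[OF cong]]
  define z where "z = x \<squnion>\<^bsub>D k\<^esub> y"
  have z: "x \<sqsubseteq>\<^bsub>D k\<^esub> z" "z \<in> carrier (D k)" "g k z = b"
    using ordered_representative[OF k x(1) y(1)] x y ab by (simp_all add: z_def)
  \<comment> \<open>Joining with \<open>x\<close> turns the path from \<open>x\<close> to \<open>y\<close> into one from \<open>x\<close> to \<open>z\<close>.\<close>
  have "(x \<squnion>\<^bsub>D k\<^esub> x, z) \<in> (pullback k \<alpha> \<union> pullback k \<beta>)\<^sup>+"
    unfolding z_def using D(7)[OF D(4)[OF x(1)]] \<open>(x, y) \<in> (pullback k \<alpha> \<union> pullback k \<beta>)\<^sup>+\<close> by blast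
  then have "(x, z) \<in> (pullback k \<alpha> \<union> pullback k \<beta>)\<^sup>+" using x by (simp add: k.join_absorb)
  then obtain u v where uv: "u \<in> \<lbrace>x..z\<rbrace>\<^bsub>D k\<^esub>" "v \<in> \<lbrace>x..z\<rbrace>\<^bsub>D k\<^esub>" "u \<squnion>\<^bsub>D k\<^esub> v = z"
    "(x, u) \<in> pullback k \<alpha>" "(x, v) \<in> pullback k \<beta>"
    using split[OF k, unfolded congruence_splitting_iff] x z cong by blast
  then have "g k u \<in> \<lbrace>a..b\<rbrace>\<^bsub>M\<^esub>" "g k v \<in> \<lbrace>a..b\<rbrace>\<^bsub>M\<^esub>"
    using h(3) mono x z by (auto simp: at_least_at_most_def)
  moreover have "g k u \<squnion>\<^bsub>M\<^esub> g k v = b"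
    using uv h(4)[of u v] z by (auto simp: at_least_at_most_def)
  moreover have "(a, g k u) \<in> \<alpha>" "(a, g k v) \<in> \<beta>" using uv x by (auto simp: pullback_def)
  ultimately show "\<exists>x\<in>\<lbrace>a..b\<rbrace>\<^bsub>M\<^esub>. \<exists>y\<in>\<lbrace>a..b\<rbrace>\<^bsub>M\<^esub>. x \<squnion>\<^bsub>M\<^esub> y = b \<and> (a, x) \<in> \<alpha> \<and> (a, y) \<in> \<beta>"
    by blast
qed

end

lemma is_direct_limit_covering_cocone:
  fixes M :: "'b gorder"
  assumes "is_direct_limit I D \<phi> M"
  shows "\<exists>g. covering_cocone I D \<phi> M g"
proof -
  interpret lattice_direct_system I D \<phi> using assms by (simp add: is_direct_limit_def)
  obtain h where h: "h \<in> lattice_hom Lim M" "bij_betw h (carrier Lim) (carrier M)"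
    using assms by (auto simp: is_direct_limit_def lattice_iso_def)
  note H = lattice_hom_props[OF h(1)]
  have "covering_cocone I D \<phi> M (\<lambda>i x. h (\<iota> i x))"
  proof (unfold_locales)
    fix i assume i: "i \<in> carrier I"
    interpret i: lattice "D i" using lattice i by blast
    show "(\<lambda>x. h (\<iota> i x)) \<in> lattice_hom (D i) M"
      using i H limit_map_closed limit_join limit_meet i.lattice_axioms
      by (simp add: lattice_hom_def join_pres_def meet_pres_def flip: limit_join limit_meet)
  next
    fix z assume "z \<in> carrier M"
    then obtain X where "X \<in> carrier Lim" "h X = z" using h(2) by (metis bij_betw_imp_surj_on imageE)
    then show "\<exists>i\<in>carrier I. \<exists>x\<in>carrier (D i). h (\<iota> i x) = z" by (metis limit_carrierE)
  qed (simp add: limit_map_compat)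
  then show ?thesis by blast
qed

theorem proposition3p2:
  shows "(\<forall>L :: 'a gorder. lattice L \<longrightarrow> relatively_complemented L \<longrightarrow> property_C L)
    \<and> (\<forall>L :: 'a gorder. lattice L \<longrightarrow> sectionally_complemented L \<longrightarrow> property_C L)
    \<and> (\<forall>L :: 'a gorder. lattice L \<longrightarrow> atomistic L \<longrightarrow> property_C L)
    \<and> (\<forall>(I :: 'i gorder) (D :: 'i \<Rightarrow> 'a gorder) \<phi> (M :: 'b gorder).
          is_direct_limit I D \<phi> M \<longrightarrow> (\<forall>i\<in>carrier I. property_C (D i)) \<longrightarrow> property_C M)
    \<and> (\<forall>L :: 'a gorder. lattice L \<longrightarrow> property_C L \<longrightarrow> congruence_splitting L)
    \<and> (\<forall>(I :: 'i gorder) (D :: 'i \<Rightarrow> 'a gorder) \<phi> (M :: 'b gorder).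
          is_direct_limit I D \<phi> M \<longrightarrow> (\<forall>i\<in>carrier I. congruence_splitting (D i)) \<longrightarrow>
          congruence_splitting M)"
  using gorder_lattice.relatively_complemented_property_C gorder_lattice.sectionally_complemented_property_C
    gorder_lattice.atomistic_property_C gorder_lattice.property_C_congruence_splitting
    gorder_lattice.intro
  by (intro conjI allI impI)
    (blast | metis is_direct_limit_covering_cocone covering_cocone.property_C_target
      covering_cocone.congruence_splitting_target)+

end
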